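(* Let $b_1,b_2$ be distinct real numbers with $0<b_1,b_2<1$. Let $u(x,y)$, $x,y=1,2,\dots$, and $\chi(x),\psi(y)$, $x,y=0,1,2,\dots$, be given real functions with $\chi(0)=\psi(0)$. Let $\Phi(x,y)$, $x,y=0,1,2,\dots$, be the (unique) solution of $$\Phi(x+1,y+1)-b_1\Phi(x,y+1)-b_2\Phi(x+1,y)+(b_1+b_2-1)\Phi(x,y)=u(x+1,y+1),\qquad x,y=0,1,2,\dots,$$ with boundary conditions $\Phi(x,0)=\chi(x)$, $\Phi(0,y)=\psi(y)$, $x,y=0,1,2,\dots$. Then for all $X,Y=0,1,2,\dots$, $$\Phi(X,Y)=\chi(0)\,\mathcal R^d(X,Y;0,0)+\sum_{y=1}^Y\mathcal R^d(X,Y;0,y)\bigl(\psi(y)-b_2\psi(y-1)\bigr)+\sum_{x=1}^X\mathcal R^d(X,Y;x,0)\bigl(\chi(x)-b_1\chi(x-1)\bigr)$$ $$+\sum_{x=1}^X\sum_{y=1}^Y\mathcal R^d(X,Y;x,y)\,u(x,y),$$ where $\mathcal R^d$ is the discrete Riemann function.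
   Context: The discrete Riemann function is $$\mathcal R^d(X,Y;x,y)=\frac1{2\pi\mathbf i}\oint_{-\frac1{b_2(1-b_1)}}\frac{(b_2-b_1)\,dz}{(1+b_2(1-b_1)z)(1+b_1(1-b_2)z)}\left(\frac{1+b_1(1-b_1)z}{1+b_2(1-b_1)z}\right)^{X-x}\left(\frac{1+b_2(1-b_2)z}{1+b_1(1-b_2)z}\right)^{Y-y},$$ where the integration goes in the positive direction and encircles $-\frac1{b_2(1-b_1)}$, but not $-\frac1{b_1(1-b_2)}$. *)

theory Defs
  imports "HOL-Complex_Analysis.Complex_Analysis"
begin

text \<open>
  A closed contour with winding number 1 about the pole \<open>-1/(b2(1-b1))\<close> and winding
  number 0 about the pole \<open>-1/(b1(1-b2))\<close>; it need not be a simple curve.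
\<close>

definition riemann_contour :: "real \<Rightarrow> real \<Rightarrow> (real \<Rightarrow> complex) \<Rightarrow> bool" where
  "riemann_contour b1 b2 \<gamma> \<longleftrightarrow>
     valid_path \<gamma> \<and> pathfinish \<gamma> = pathstart \<gamma> \<and>
     complex_of_real (- 1 / (b2 * (1 - b1))) \<notin> path_image \<gamma> \<and>
     complex_of_real (- 1 / (b1 * (1 - b2))) \<notin> path_image \<gamma> \<and>
     winding_number \<gamma> (complex_of_real (- 1 / (b2 * (1 - b1)))) = 1 \<and>
     winding_number \<gamma> (complex_of_real (- 1 / (b1 * (1 - b2)))) = 0"

text \<open>
  The exponents are integer differences, so there is no truncated subtraction. For
  \<open>x \<le> X\<close> and \<open>y \<le> Y\<close> the integrand has no singularities
  other than the two poles above, and the value does not depend on the choice of the contour.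
\<close>

definition discrete_Riemann ::
  "real \<Rightarrow> real \<Rightarrow> (real \<Rightarrow> complex) \<Rightarrow> nat \<Rightarrow> nat \<Rightarrow> nat \<Rightarrow> nat \<Rightarrow> complex" where
  "discrete_Riemann b1 b2 \<gamma> X Y x y =
     1 / (2 * of_real pi * \<i>) *
     contour_integral \<gamma> (\<lambda>z.
       of_real (b2 - b1) /
         ((1 + of_real (b2 * (1 - b1)) * z) * (1 + of_real (b1 * (1 - b2)) * z)) *
       ((1 + of_real (b1 * (1 - b1)) * z) / (1 + of_real (b2 * (1 - b1)) * z))
         powi (int X - int x) *
       ((1 + of_real (b2 * (1 - b2)) * z) / (1 + of_real (b1 * (1 - b2)) * z))
         powi (int Y - int y))"

definition solves_discrete_telegraph ::
  "real \<Rightarrow> real \<Rightarrow> (nat \<Rightarrow> nat \<Rightarrow> real) \<Rightarrow> (nat \<Rightarrow> real) \<Rightarrow> (nat \<Rightarrow> real) \<Rightarrow>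
   (nat \<Rightarrow> nat \<Rightarrow> real) \<Rightarrow> bool" where
  "solves_discrete_telegraph b1 b2 u chi psi \<Phi> \<longleftrightarrow>
     (\<forall>x y. \<Phi> (x + 1) (y + 1) - b1 * \<Phi> x (y + 1) - b2 * \<Phi> (x + 1) y
             + (b1 + b2 - 1) * \<Phi> x y = u (x + 1) (y + 1)) \<and>
     (\<forall>x. \<Phi> x 0 = chi x) \<and>
     (\<forall>y. \<Phi> 0 y = psi y)"

end

theory Submission imports Defs begin

text \<open>
  Extend every function on the quarter plane by \<open>0\<close> to negative arguments, and let \<open>L\<close> be the
  operator \<open>F \<mapsto> F(x,y) - b1 F(x-1,y) - b2 F(x,y-1) + (b1+b2-1) F(x-1,y-1)\<close>. The data of the
  problem, namely the source \<open>u\<close> in the interior, the differences \<open>\<chi>(x) - b1 \<chi>(x-1)\<close> and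
  \<open>\<psi>(y) - b2 \<psi>(y-1)\<close> on the two axes and \<open>\<chi>(0)\<close> in the corner, are exactly the values of \<open>L \<Phi>\<close>
  for the extended \<open>\<Phi>\<close>. Since \<open>L\<close> is an injective convolution operator, the claimed formula says
  that \<open>\<Phi>\<close> is the convolution of \<open>L \<Phi>\<close> with a fundamental solution: the kernel
  \<open>r(X-x,Y-y) = R(X,Y;x,y)\<close> has to satisfy \<open>L r = \<delta>\<close>. The convolution argument is
  \<open>fundamental_solution_representation\<close>.

  That \<open>L r = \<delta>\<close> follows from the shape of the integrand
  \<open>(b2-b1)/(p q) \<xi>^m \<eta>^n\<close>, where \<open>p\<close> and \<open>q\<close> are the two linear denominators. The identities
  \<open>\<xi> - b1 = (1-b1) q/p\<close> and \<open>\<eta> - b2 = (1-b2) p/q\<close> show that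
  \<open>(\<xi> - b1)(\<eta> - b2) = (1-b1)(1-b2)\<close>, which makes \<open>L\<close> vanish already on the integrand in the
  interior. On the axes they cancel one of the two denominators and turn the integrand into
  \<open>-\<xi>' \<xi>^m\<close> or \<open>\<eta>' \<eta>^n\<close>, which has a primitive. In the corner, partial fractions turn the
  integrand into the difference of the Cauchy kernels at the two poles, so that the integral is the
  difference \<open>1 - 0\<close> of the winding numbers. No residue of higher order is ever computed.
\<close>

section \<open>Fundamental solutions on the quarter plane\<close>

text \<open>
  This is \<open>L F\<close> for the extension of \<open>F\<close> by zero to negative arguments; the four cases write out
  which terms survive.
\<close>

fun telegraph_source ::
  "'a::comm_ring_1 \<Rightarrow> 'a \<Rightarrow> (nat \<Rightarrow> nat \<Rightarrow> 'a) \<Rightarrow> nat \<Rightarrow> nat \<Rightarrow> 'a" where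
  "telegraph_source c1 c2 F 0 0 = F 0 0"
| "telegraph_source c1 c2 F (Suc x) 0 = F (Suc x) 0 - c1 * F x 0"
| "telegraph_source c1 c2 F 0 (Suc y) = F 0 (Suc y) - c2 * F 0 y"
| "telegraph_source c1 c2 F (Suc x) (Suc y) =
     F (Suc x) (Suc y) - c1 * F x (Suc y) - c2 * F (Suc x) y + (c1 + c2 - 1) * F x y"

definition quarter_plane_convolution ::
  "(nat \<Rightarrow> nat \<Rightarrow> 'a::comm_ring_1) \<Rightarrow> (nat \<Rightarrow> nat \<Rightarrow> 'a) \<Rightarrow> nat \<Rightarrow> nat \<Rightarrow> 'a" where
  "quarter_plane_convolution k w X Y = (\<Sum>x\<le>X. \<Sum>y\<le>Y. k (X - x) (Y - y) * w x y)"

definition fundamental_solution ::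
  "'a::comm_ring_1 \<Rightarrow> 'a \<Rightarrow> (nat \<Rightarrow> nat \<Rightarrow> 'a) \<Rightarrow> bool" where
  "fundamental_solution c1 c2 k \<longleftrightarrow>
     (\<forall>m n. telegraph_source c1 c2 k m n = (if m = 0 \<and> n = 0 then 1 else 0))"

text \<open>
  The value at each point is its source term plus a combination of values at predecessors, so the
  source determines the function point by point.
\<close>

lemma telegraph_source_inject:
  assumes "\<And>x y. telegraph_source c1 c2 F x y = telegraph_source c1 c2 G x y"
  shows "F x y = G x y"
proof (induction "x + y" arbitrary: x y rule: less_induct)
  case less
  show ?case
  proof (cases x; cases y)
    assume "x = 0" "y = 0"
    then show ?thesis using assms[of 0 0] by simp
  next
    fix y' assume "x = 0" "y = Suc y'"
    then show ?thesis using assms[of 0 "Suc y'"] less[of 0 y'] by simp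
  next
    fix x' assume "x = Suc x'" "y = 0"
    then show ?thesis using assms[of "Suc x'" 0] less[of x' 0] by simp
  next
    fix x' y' assume "x = Suc x'" "y = Suc y'"
    then show ?thesis
      using assms[of "Suc x'" "Suc y'"] less[of x' "Suc y'"] less[of "Suc x'" y'] less[of x' y']
      by simp
  qed
qed

text \<open>
  \<open>L\<close> commutes with translations, so \<open>L (k * w) = (L k) * w = \<delta> * w = w\<close>. At an interior point the
  sum splits into the points strictly before it in both directions, the last column, the last row
  and the corner, according to which translates of \<open>k\<close> have been cut off at zero.
\<close>

lemma telegraph_source_convolution:
  assumes "fundamental_solution c1 c2 k"
  shows "telegraph_source c1 c2 (quarter_plane_convolution k w) X Y = w X Y"
proof -
  have k: "telegraph_source c1 c2 k m n = (if m = 0 \<and> n = 0 then 1 else 0)" for m n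
    using assms by (simp add: fundamental_solution_def)
  have k00: "k 0 0 = 1" using k[of 0 0] by simp
  have kx: "k (Suc m) 0 = c1 * k m 0" for m using k[of "Suc m" 0] by simp
  have ky: "k 0 (Suc n) = c2 * k 0 n" for n using k[of 0 "Suc n"] by simp
  have kxy: "k (Suc m) (Suc n) = c1 * k m (Suc n) + c2 * k (Suc m) n - (c1 + c2 - 1) * k m n"
    for m n using k[of "Suc m" "Suc n"] by (simp add: algebra_simps)
  note F = quarter_plane_convolution_def
  show ?thesis
  proof (cases X; cases Y)
    assume "X = 0" "Y = 0"
    then show ?thesis by (simp add: F k00)
  next
    fix Y' assume "X = 0" "Y = Suc Y'"
    then show ?thesis
      by (simp add: F k00 ky Suc_diff_le sum_distrib_left mult.assoc)
  next
    fix X' assume "X = Suc X'" "Y = 0"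
    then show ?thesis
      by (simp add: F k00 kx Suc_diff_le sum_distrib_left mult.assoc)
  next
    fix X' Y' assume [simp]: "X = Suc X'" "Y = Suc Y'"
    define S where "S i j = (\<Sum>x\<le>X'. \<Sum>y\<le>Y'. k (i + (X' - x)) (j + (Y' - y)) * w x y)" for i j
    define C where "C j = (\<Sum>y\<le>Y'. k 0 (j + (Y' - y)) * w (Suc X') y)" for j
    define D where "D i = (\<Sum>x\<le>X'. k (i + (X' - x)) 0 * w x (Suc Y'))" for i
    have S: "S 1 1 = c1 * S 0 1 + c2 * S 1 0 - (c1 + c2 - 1) * S 0 0"
      by (simp add: S_def kxy sum_distrib_left sum.distrib sum_subtractf algebra_simps)
    have C: "C 1 = c2 * C 0"
      by (simp add: C_def ky sum_distrib_left mult.assoc)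
    have D: "D 1 = c1 * D 0"
      by (simp add: D_def kx sum_distrib_left mult.assoc)
    have F11: "quarter_plane_convolution k w (Suc X') (Suc Y') =
        S 1 1 + C 1 + D 1 + w (Suc X') (Suc Y')"
      by (simp add: F S_def C_def D_def k00 Suc_diff_le sum.distrib algebra_simps)
    have F01: "quarter_plane_convolution k w X' (Suc Y') = S 0 1 + D 0"
      by (simp add: F S_def D_def Suc_diff_le sum.distrib)
    have F10: "quarter_plane_convolution k w (Suc X') Y' = S 1 0 + C 0"
      by (simp add: F S_def C_def Suc_diff_le)
    have F00: "quarter_plane_convolution k w X' Y' = S 0 0"
      by (simp add: F S_def)
    show ?thesis
      by (simp add: F11 F01 F10 F00 S C D algebra_simps del: One_nat_def)
  qed
qed

theorem fundamental_solution_representation: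
  assumes "fundamental_solution c1 c2 k"
  shows "F X Y = quarter_plane_convolution k (telegraph_source c1 c2 F) X Y"
  by (rule telegraph_source_inject[of c1 c2])
    (simp add: telegraph_source_convolution[OF assms])

text \<open>The four parts of the sum correspond to the four cases of \<open>telegraph_source\<close>.\<close>

lemma quarter_plane_convolution_split_axes:
  "quarter_plane_convolution k w X Y =
     k X Y * w 0 0 + (\<Sum>y = 1..Y. k X (Y - y) * w 0 y) + (\<Sum>x = 1..X. k (X - x) Y * w x 0)
     + (\<Sum>x = 1..X. \<Sum>y = 1..Y. k (X - x) (Y - y) * w x y)"
proof -
  have 0: "{..n} = insert 0 {1..n}" for n :: nat by auto
  show ?thesis
    unfolding quarter_plane_convolution_def 0 by (simp add: sum.distrib)
qed

section \<open>The contour integral kernel is a fundamental solution\<close>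

text \<open>
  The two poles are the zeros of the linear denominators \<open>p z = 1 + b2 (1 - b1) z\<close> and
  \<open>q z = 1 + b1 (1 - b2) z\<close>. The bounds on the parameters make them nonconstant.
\<close>

locale riemann_kernel =
  fixes b1 b2 :: real and \<gamma> :: "real \<Rightarrow> complex"
  assumes b1: "0 < b1" "b1 < 1" and b2: "0 < b2" "b2 < 1"
    and contour: "riemann_contour b1 b2 \<gamma>"
begin

abbreviation c1 :: complex where "c1 \<equiv> complex_of_real b1"
abbreviation c2 :: complex where "c2 \<equiv> complex_of_real b2"

definition p :: "complex \<Rightarrow> complex" where "p z = 1 + c2 * (1 - c1) * z"
definition q :: "complex \<Rightarrow> complex" where "q z = 1 + c1 * (1 - c2) * z"
definition \<xi> :: "complex \<Rightarrow> complex" where "\<xi> z = (1 + c1 * (1 - c1) * z) / p z"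
definition \<eta> :: "complex \<Rightarrow> complex" where "\<eta> z = (1 + c2 * (1 - c2) * z) / q z"

definition integrand :: "nat \<Rightarrow> nat \<Rightarrow> complex \<Rightarrow> complex" where
  "integrand m n z = (c2 - c1) / (p z * q z) * \<xi> z ^ m * \<eta> z ^ n"

lemma integrand_Suc: "integrand (Suc m) n z = \<xi> z * integrand m n z"
    "integrand m (Suc n) z = \<eta> z * integrand m n z"
  by (simp_all add: integrand_def)

definition kernel :: "nat \<Rightarrow> nat \<Rightarrow> complex" where
  "kernel m n = 1 / (2 * of_real pi * \<i>) * contour_integral \<gamma> (integrand m n)"

definition regular :: "complex set" where "regular = {z. p z \<noteq> 0 \<and> q z \<noteq> 0}"

definition pole1 :: complex where "pole1 = complex_of_real (- 1 / (b2 * (1 - b1)))"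
definition pole2 :: complex where "pole2 = complex_of_real (- 1 / (b1 * (1 - b2)))"

lemma slopes_nonzero: "c2 * (1 - c1) \<noteq> 0" "c1 * (1 - c2) \<noteq> 0"
  using b1 b2 by auto

lemma p_factor: "p z = c2 * (1 - c1) * (z - pole1)"
  and q_factor: "q z = c1 * (1 - c2) * (z - pole2)"
  using slopes_nonzero by (simp_all add: p_def q_def pole1_def pole2_def field_simps)

lemma regular_eq: "regular = - {pole1, pole2}"
  using slopes_nonzero by (auto simp: regular_def p_factor q_factor)

lemma open_regular: "open regular"
  by (simp add: regular_eq open_Compl)

lemma regular_nonzero: "z \<in> regular \<Longrightarrow> p z \<noteq> 0" "z \<in> regular \<Longrightarrow> q z \<noteq> 0"
  by (simp_all add: regular_def)

lemma path_in_regular: "path_image \<gamma> \<subseteq> regular"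
  using contour by (auto simp: riemann_contour_def regular_eq pole1_def pole2_def)

lemma valid_path_contour: "valid_path \<gamma>" "pathfinish \<gamma> = pathstart \<gamma>"
  using contour by (auto simp: riemann_contour_def)

lemma integrand_integrable: "integrand m n contour_integrable_on \<gamma>"
proof (rule contour_integrable_holomorphic_simple[OF _ open_regular valid_path_contour(1)
    path_in_regular])
  show "integrand m n holomorphic_on regular"
    using regular_nonzero unfolding integrand_def \<xi>_def \<eta>_def p_def q_def
    by (intro holomorphic_intros) auto
qed

text \<open>
  The recurrences below are derived for the integrand away from the poles; this transfers them to
  the integrals. It has four terms because the equation has four.
\<close>

lemma kernel_linear:
  assumes "\<And>z. z \<in> regular \<Longrightarrow>
    integrand m n z - a * integrand m' n' z - b * integrand m'' n'' z
      + c * integrand m''' n''' z = f z"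
  shows "kernel m n - a * kernel m' n' - b * kernel m'' n'' + c * kernel m''' n''' =
    1 / (2 * of_real pi * \<i>) * contour_integral \<gamma> f"
proof -
  note hi = has_contour_integral_integral[OF integrand_integrable]
  have "((\<lambda>z. integrand m n z - a * integrand m' n' z - b * integrand m'' n'' z
      + c * integrand m''' n''' z) has_contour_integral
    (contour_integral \<gamma> (integrand m n) - a * contour_integral \<gamma> (integrand m' n')
      - b * contour_integral \<gamma> (integrand m'' n'')
      + c * contour_integral \<gamma> (integrand m''' n'''))) \<gamma>"
    by (intro has_contour_integral_add has_contour_integral_diff has_contour_integral_lmul hi)
  then have "(f has_contour_integral
    (contour_integral \<gamma> (integrand m n) - a * contour_integral \<gamma> (integrand m' n')
      - b * contour_integral \<gamma> (integrand m'' n'')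
      + c * contour_integral \<gamma> (integrand m''' n'''))) \<gamma>"
    by (rule has_contour_integral_eq) (use assms path_in_regular in auto)
  then have "contour_integral \<gamma> f =
     contour_integral \<gamma> (integrand m n) - a * contour_integral \<gamma> (integrand m' n')
      - b * contour_integral \<gamma> (integrand m'' n'')
      + c * contour_integral \<gamma> (integrand m''' n''')"
    by (rule contour_integral_unique)
  then show ?thesis
    unfolding kernel_def by (simp only: ring_distribs mult.left_commute)
qed

text \<open>
  These two identities drive everything: each factor of the integrand differs from a constant by
  a multiple of the quotient of the two denominators, and the quotients are reciprocal.
\<close>

lemma \<xi>_minus: "z \<in> regular \<Longrightarrow> \<xi> z - c1 = (1 - c1) * q z / p z"
  and \<eta>_minus: "z \<in> regular \<Longrightarrow> \<eta> z - c2 = (1 - c2) * p z / q z"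
proof -
  assume z: "z \<in> regular"
  have "1 + c1 * (1 - c1) * z - c1 * p z = (1 - c1) * q z"
    "1 + c2 * (1 - c2) * z - c2 * q z = (1 - c2) * p z"
    by (simp_all add: p_def q_def algebra_simps)
  moreover have "\<xi> z - c1 = (1 + c1 * (1 - c1) * z - c1 * p z) / p z"
    "\<eta> z - c2 = (1 + c2 * (1 - c2) * z - c2 * q z) / q z"
    using regular_nonzero[OF z] by (simp_all add: \<xi>_def \<eta>_def diff_divide_distrib)
  ultimately show "\<xi> z - c1 = (1 - c1) * q z / p z" "\<eta> z - c2 = (1 - c2) * p z / q z"
    by simp_all
qed

lemma DERIV_\<xi>:
  assumes z: "z \<in> regular"
  shows "(\<xi> has_field_derivative - ((c2 - c1) * (1 - c1) / (p z)\<^sup>2)) (at z)"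
proof -
  have "(\<xi> has_field_derivative
      (c1 * (1 - c1) * p z - (1 + c1 * (1 - c1) * z) * (c2 * (1 - c1))) / (p z * p z)) (at z)"
    using regular_nonzero[OF z] unfolding \<xi>_def p_def
    by (auto intro!: derivative_eq_intros)
  moreover have "c1 * (1 - c1) * p z - (1 + c1 * (1 - c1) * z) * (c2 * (1 - c1))
      = - ((c2 - c1) * (1 - c1))"
    by (simp add: p_def algebra_simps)
  ultimately show ?thesis by (simp add: power2_eq_square)
qed

lemma DERIV_\<eta>:
  assumes z: "z \<in> regular"
  shows "(\<eta> has_field_derivative (c2 - c1) * (1 - c2) / (q z)\<^sup>2) (at z)"
proof -
  have "(\<eta> has_field_derivative
      (c2 * (1 - c2) * q z - (1 + c2 * (1 - c2) * z) * (c1 * (1 - c2))) / (q z * q z)) (at z)"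
    using regular_nonzero[OF z] unfolding \<eta>_def q_def
    by (auto intro!: derivative_eq_intros)
  moreover have "c2 * (1 - c2) * q z - (1 + c2 * (1 - c2) * z) * (c1 * (1 - c2))
      = (c2 - c1) * (1 - c2)"
    by (simp add: q_def algebra_simps)
  ultimately show ?thesis by (simp add: power2_eq_square)
qed

lemma has_contour_integral_power_times_deriv:
  fixes f f' :: "complex \<Rightarrow> complex"
  assumes "\<And>z. z \<in> regular \<Longrightarrow> (f has_field_derivative f' z) (at z)"
  shows "((\<lambda>z. f' z * f z ^ m) has_contour_integral 0) \<gamma>"
proof (rule Cauchy_theorem_primitive)
  fix z assume z: "z \<in> regular"
  show "((\<lambda>z. f z ^ Suc m / of_nat (Suc m)) has_field_derivative f' z * f z ^ m)
      (at z within regular)"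
    using DERIV_cdivide[OF DERIV_power_Suc[OF has_field_derivative_at_within[OF assms[OF z]]],
        of m "of_nat (Suc m)" regular]
    by (simp del: of_nat_Suc add: of_nat_Suc[symmetric])
qed (use valid_path_contour path_in_regular in auto)

text \<open>
  Partial fractions write the integrand as \<open>1/(z - pole1) - 1/(z - pole2)\<close>, so this is the
  difference of the two winding numbers.
\<close>

lemma kernel_0_0: "kernel 0 0 = 1"
proof -
  have w: "((\<lambda>z. 1 / (z - a)) has_contour_integral 2 * of_real pi * \<i> * winding_number \<gamma> a) \<gamma>"
    if "a \<notin> path_image \<gamma>" for a
    using has_contour_integral_winding_number[OF valid_path_contour(1) that] by simp
  have pf: "1 / (z - pole1) - 1 / (z - pole2) = integrand 0 0 z" if z: "z \<in> regular" for z
  proof -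
    have "integrand 0 0 z = (c2 * (1 - c1) * q z - c1 * (1 - c2) * p z) / (p z * q z)"
      by (simp add: integrand_def p_def q_def algebra_simps)
    also have "\<dots> = c2 * (1 - c1) / p z - c1 * (1 - c2) / q z"
      using regular_nonzero[OF z] by (simp add: diff_frac_eq)
    also have "\<dots> = 1 / (z - pole1) - 1 / (z - pole2)"
      using slopes_nonzero by (simp add: p_factor q_factor)
    finally show ?thesis by simp
  qed
  have notin: "pole1 \<notin> path_image \<gamma>" "pole2 \<notin> path_image \<gamma>"
    and wn: "winding_number \<gamma> pole1 = 1" "winding_number \<gamma> pole2 = 0"
    using contour by (simp_all add: riemann_contour_def pole1_def pole2_def)
  have "((\<lambda>z. 1 / (z - pole1) - 1 / (z - pole2)) has_contour_integral 2 * of_real pi * \<i>) \<gamma>"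
    using has_contour_integral_diff[OF w[OF notin(1)] w[OF notin(2)]] by (simp add: wn)
  then have "(integrand 0 0 has_contour_integral 2 * of_real pi * \<i>) \<gamma>"
    by (rule has_contour_integral_eq) (use pf path_in_regular in auto)
  then show ?thesis by (simp add: kernel_def contour_integral_unique)
qed

lemma kernel_Suc_0: "kernel (Suc m) 0 = c1 * kernel m 0"
proof -
  have "integrand (Suc m) 0 z - c1 * integrand m 0 z =
      - (- ((c2 - c1) * (1 - c1) / (p z)\<^sup>2) * \<xi> z ^ m)" if z: "z \<in> regular" for z
  proof -
    have "integrand (Suc m) 0 z - c1 * integrand m 0 z
        = (\<xi> z - c1) * integrand m 0 z"
      by (simp only: integrand_Suc left_diff_distrib)
    then show ?thesis
      using regular_nonzero[OF z] by (simp add: integrand_def \<xi>_minus[OF z] power2_eq_square)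
  qed
  from kernel_linear[of "Suc m" 0 c1 m 0 0 0 0 0 0 0, simplified, OF this]
  show ?thesis
    using has_contour_integral_neg[OF has_contour_integral_power_times_deriv[OF DERIV_\<xi>, of m]]
    by (simp add: contour_integral_unique)
qed

lemma kernel_0_Suc: "kernel 0 (Suc n) = c2 * kernel 0 n"
proof -
  have "integrand 0 (Suc n) z - c2 * integrand 0 n z =
      (c2 - c1) * (1 - c2) / (q z)\<^sup>2 * \<eta> z ^ n" if z: "z \<in> regular" for z
  proof -
    have "integrand 0 (Suc n) z - c2 * integrand 0 n z
        = (\<eta> z - c2) * integrand 0 n z"
      by (simp only: integrand_Suc left_diff_distrib)
    then show ?thesis
      using regular_nonzero[OF z] by (simp add: integrand_def \<eta>_minus[OF z] power2_eq_square)
  qed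
  from kernel_linear[of 0 "Suc n" c2 0 n 0 0 0 0 0 0, simplified, OF this]
  show ?thesis
    using has_contour_integral_power_times_deriv[OF DERIV_\<eta>, of n]
    by (simp add: contour_integral_unique)
qed

text \<open>
  The equation holds pointwise for the integrand, because it amounts to
  \<open>(\<xi> - b1) (\<eta> - b2) = (1 - b1) (1 - b2)\<close>.
\<close>

lemma kernel_Suc_Suc:
  "kernel (Suc m) (Suc n) - c1 * kernel m (Suc n) - c2 * kernel (Suc m) n
     + (c1 + c2 - 1) * kernel m n = 0"
proof -
  have "integrand (Suc m) (Suc n) z - c1 * integrand m (Suc n) z - c2 * integrand (Suc m) n z
     + (c1 + c2 - 1) * integrand m n z = 0" if z: "z \<in> regular" for z
  proof -
    have "(\<xi> z - c1) * (\<eta> z - c2) = (1 - c1) * (1 - c2)"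
      using regular_nonzero[OF z] by (simp add: \<xi>_minus[OF z] \<eta>_minus[OF z])
    then have 0: "\<xi> z * \<eta> z - c1 * \<eta> z - c2 * \<xi> z + (c1 + c2 - 1) = 0"
      by (simp add: algebra_simps)
    have "integrand (Suc m) (Suc n) z - c1 * integrand m (Suc n) z
        - c2 * integrand (Suc m) n z + (c1 + c2 - 1) * integrand m n z
      = integrand m n z * (\<xi> z * \<eta> z - c1 * \<eta> z - c2 * \<xi> z + (c1 + c2 - 1))"
      by (simp add: integrand_Suc algebra_simps)
    with 0 show ?thesis by simp
  qed
  from kernel_linear[OF this] show ?thesis by simp
qed

theorem fundamental_solution_kernel: "fundamental_solution c1 c2 kernel"
  unfolding fundamental_solution_def
proof (intro allI)
  fix m n
  show "telegraph_source c1 c2 kernel m n = (if m = 0 \<and> n = 0 then 1 else 0)"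
    by (cases m; cases n) (simp_all add: kernel_0_0 kernel_Suc_0 kernel_0_Suc kernel_Suc_Suc)
qed

lemma discrete_Riemann_eq_kernel:
  assumes "x \<le> X" "y \<le> Y"
  shows "discrete_Riemann b1 b2 \<gamma> X Y x y = kernel (X - x) (Y - y)"
proof -
  have "int X - int x = int (X - x)" "int Y - int y = int (Y - y)"
    using assms by auto
  then show ?thesis
    unfolding discrete_Riemann_def kernel_def integrand_def \<xi>_def \<eta>_def p_def q_def
    by (simp only: power_int_of_nat of_real_mult of_real_diff of_real_1)
qed

end

section \<open>The boundary value problem\<close>

fun telegraph_solution ::
  "real \<Rightarrow> real \<Rightarrow> (nat \<Rightarrow> nat \<Rightarrow> real) \<Rightarrow> (nat \<Rightarrow> real) \<Rightarrow> (nat \<Rightarrow> real) \<Rightarrow> nat \<Rightarrow> nat \<Rightarrow> real" where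
  "telegraph_solution b1 b2 u chi psi x 0 = chi x"
| "telegraph_solution b1 b2 u chi psi 0 (Suc y) = psi (Suc y)"
| "telegraph_solution b1 b2 u chi psi (Suc x) (Suc y) =
     u (Suc x) (Suc y) + b1 * telegraph_solution b1 b2 u chi psi x (Suc y)
       + b2 * telegraph_solution b1 b2 u chi psi (Suc x) y
       - (b1 + b2 - 1) * telegraph_solution b1 b2 u chi psi x y"

lemma solves_telegraph_solution:
  assumes "chi 0 = psi 0"
  shows "solves_discrete_telegraph b1 b2 u chi psi (telegraph_solution b1 b2 u chi psi)"
  unfolding solves_discrete_telegraph_def
proof (intro conjI allI)
  show "telegraph_solution b1 b2 u chi psi 0 y = psi y" for y
    using assms by (cases y) auto
qed (auto simp: algebra_simps)

lemma telegraph_source_of_solution: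
  assumes "solves_discrete_telegraph b1 b2 u chi psi \<Phi>"
  shows "telegraph_source b1 b2 \<Phi> 0 0 = chi 0"
    and "x \<ge> 1 \<Longrightarrow> telegraph_source b1 b2 \<Phi> x 0 = chi x - b1 * chi (x - 1)"
    and "y \<ge> 1 \<Longrightarrow> telegraph_source b1 b2 \<Phi> 0 y = psi y - b2 * psi (y - 1)"
    and "x \<ge> 1 \<Longrightarrow> y \<ge> 1 \<Longrightarrow> telegraph_source b1 b2 \<Phi> x y = u x y"
  using assms unfolding solves_discrete_telegraph_def by (cases x; cases y; simp)+

lemma solution_unique:
  assumes "solves_discrete_telegraph b1 b2 u chi psi \<Phi>"
    and "solves_discrete_telegraph b1 b2 u chi psi \<Psi>"
  shows "\<Phi> = \<Psi>"
proof (intro ext, rule telegraph_source_inject)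
  fix x y
  show "telegraph_source b1 b2 \<Phi> x y = telegraph_source b1 b2 \<Psi> x y"
    by (cases x; cases y)
      (simp_all add: telegraph_source_of_solution[OF assms(1)]
        telegraph_source_of_solution[OF assms(2)] del: telegraph_source.simps)
qed

lemma telegraph_source_of_real:
  "telegraph_source (complex_of_real b1) (of_real b2) (\<lambda>x y. of_real (\<Phi> x y)) =
     (\<lambda>x y. of_real (telegraph_source b1 b2 \<Phi> x y))"
proof (intro ext)
  show "telegraph_source (complex_of_real b1) (of_real b2) (\<lambda>x y. of_real (\<Phi> x y)) x y =
     of_real (telegraph_source b1 b2 \<Phi> x y)" for x y
    by (cases x; cases y) simp_all
qed

theorem theorem4p7:
  fixes b1 b2 :: real
    and u :: "nat \<Rightarrow> nat \<Rightarrow> real"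
    and chi psi :: "nat \<Rightarrow> real"
    and \<gamma> :: "real \<Rightarrow> complex"
  assumes "b1 \<noteq> b2"
    and "0 < b1" "b1 < 1"
    and "0 < b2" "b2 < 1"
    and "chi 0 = psi 0"
    and "riemann_contour b1 b2 \<gamma>"
  shows "(\<exists>!\<Phi>. solves_discrete_telegraph b1 b2 u chi psi \<Phi>) \<and>
    (\<forall>\<Phi>. solves_discrete_telegraph b1 b2 u chi psi \<Phi> \<longrightarrow>
      (\<forall>X Y. complex_of_real (\<Phi> X Y) =
          of_real (chi 0) * discrete_Riemann b1 b2 \<gamma> X Y 0 0
        + (\<Sum>y = 1..Y. discrete_Riemann b1 b2 \<gamma> X Y 0 y * of_real (psi y - b2 * psi (y - 1)))
        + (\<Sum>x = 1..X. discrete_Riemann b1 b2 \<gamma> X Y x 0 * of_real (chi x - b1 * chi (x - 1)))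
        + (\<Sum>x = 1..X. \<Sum>y = 1..Y. discrete_Riemann b1 b2 \<gamma> X Y x y * of_real (u x y))))"
proof (intro conjI allI impI)
  show "\<exists>!\<Phi>. solves_discrete_telegraph b1 b2 u chi psi \<Phi>"
    using solves_telegraph_solution[of chi psi, OF assms(6)] solution_unique by blast
next
  fix \<Phi> X Y
  assume sol: "solves_discrete_telegraph b1 b2 u chi psi \<Phi>"
  \<comment> \<open>The complexified solution is represented by the kernel; the four cases of its source are the
    given data.\<close>
  interpret riemann_kernel b1 b2 \<gamma>
    by unfold_locales (use assms in auto)
  define w where "w x y = complex_of_real (telegraph_source b1 b2 \<Phi> x y)" for x y
  have "complex_of_real (\<Phi> X Y) = quarter_plane_convolution kernel w X Y"
    using fundamental_solution_representation[OF fundamental_solution_kernel,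
        of "\<lambda>x y. of_real (\<Phi> x y)" X Y]
    by (simp add: telegraph_source_of_real w_def[abs_def])
  also have "\<dots> = kernel X Y * w 0 0 + (\<Sum>y = 1..Y. kernel X (Y - y) * w 0 y)
      + (\<Sum>x = 1..X. kernel (X - x) Y * w x 0)
      + (\<Sum>x = 1..X. \<Sum>y = 1..Y. kernel (X - x) (Y - y) * w x y)"
    by (rule quarter_plane_convolution_split_axes)
  finally show "complex_of_real (\<Phi> X Y) =
          of_real (chi 0) * discrete_Riemann b1 b2 \<gamma> X Y 0 0
        + (\<Sum>y = 1..Y. discrete_Riemann b1 b2 \<gamma> X Y 0 y * of_real (psi y - b2 * psi (y - 1)))
        + (\<Sum>x = 1..X. discrete_Riemann b1 b2 \<gamma> X Y x 0 * of_real (chi x - b1 * chi (x - 1)))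
        + (\<Sum>x = 1..X. \<Sum>y = 1..Y. discrete_Riemann b1 b2 \<gamma> X Y x y * of_real (u x y))"
    by (simp add: discrete_Riemann_eq_kernel w_def telegraph_source_of_solution[OF sol]
        del: telegraph_source.simps of_real_diff of_real_mult)
qed

end
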